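(* Let $(X,\mathcal F)$ be a measurable space, $\sigma:X\to X$ a measurable map, and $\mu$ a sigma-finite positive measure on $(X,\mathcal F)$ which is $\sigma$-invariant, i.e. $\mu(\sigma^{-1}(A))=\mu(A)$ for all $A\in\mathcal F$. Let $S$ be the isometry $f\mapsto f\circ\sigma$ from $\mathbf L^2(X,\mathcal F,\mu)$ into itself. For $g\in\mathbf L^2(X,\mathcal F,\mu)$ define $$M_g(A)=\int_X1_A(\sigma(x))g(x)\,\mu(dx),\quad A\in\mathcal F^{\rm fin}.$$ Then, for every $g\in\mathbf L^2(X,\mathcal F,\mu)$, $M_g\in\mathfrak H(\mu)$ and the adjoint of $S$ is given by the Krein-Feller derivative of $M_g$: $$S^*g=\nabla_\mu M_g.$$
   Context: $\mathcal F^{\rm fin}=\{A\in\mathcal F:\mu(A)<\infty\}$. $\mathfrak H(\mu)$ is the reproducing kernel Hilbert space of complex functions on $\mathcal F^{\rm fin}$ with reproducing kernel $\mu(A\cap B)$; it is known to consist exactly of the functions $M(A)=\int_Ah\,d\mu$ with $h\in\mathbf L^2(X,\mathcal F,\mu)$, with norm $\|M\|=\|h\|_2$. The Krein-Feller derivative $\nabla_\mu:\mathfrak H(\mu)\to\mathbf L^2(X,\mathcal F,\mu)$ sends $M$ to this (unique) $h$. *)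

theory Defs
  imports "HOL-Analysis.Analysis"
begin

section \<open>Reproducing kernel Hilbert spaces\<close>

text \<open>
  Functions on \<open>T\<close> are elements of \<open>extensional T\<close>, so that equality of functions on \<open>T\<close> is
  equality in HOL. Inner products are linear in the first argument.
\<close>

locale function_hilbert_space =
  fixes T :: "'t set" and H :: "('t \<Rightarrow> complex) set"
    and ip :: "('t \<Rightarrow> complex) \<Rightarrow> ('t \<Rightarrow> complex) \<Rightarrow> complex"
  assumes extensional: "H \<subseteq> extensional T"
    and zero_closed: "(\<lambda>t\<in>T. 0) \<in> H"
    and add_closed: "\<lbrakk>f \<in> H; g \<in> H\<rbrakk> \<Longrightarrow> (\<lambda>t\<in>T. f t + g t) \<in> H"
    and scale_closed: "f \<in> H \<Longrightarrow> (\<lambda>t\<in>T. c * f t) \<in> H"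
    and ip_add: "\<lbrakk>f \<in> H; g \<in> H; k \<in> H\<rbrakk> \<Longrightarrow> ip (\<lambda>t\<in>T. f t + g t) k = ip f k + ip g k"
    and ip_scale: "\<lbrakk>f \<in> H; k \<in> H\<rbrakk> \<Longrightarrow> ip (\<lambda>t\<in>T. c * f t) k = c * ip f k"
    and ip_cnj: "\<lbrakk>f \<in> H; g \<in> H\<rbrakk> \<Longrightarrow> ip g f = cnj (ip f g)"
    and ip_nonneg: "f \<in> H \<Longrightarrow> 0 \<le> Re (ip f f)"
    and ip_definite: "\<lbrakk>f \<in> H; ip f f = 0\<rbrakk> \<Longrightarrow> f = (\<lambda>t\<in>T. 0)"
    and complete:
      "\<lbrakk>\<And>n. u n \<in> H;
        \<forall>e>0. \<exists>N. \<forall>m\<ge>N. \<forall>n\<ge>N.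
          (let d = (\<lambda>t\<in>T. u m t - u n t) in sqrt (Re (ip d d)) < e)\<rbrakk>
       \<Longrightarrow> \<exists>f\<in>H. (\<lambda>n. let d = (\<lambda>t\<in>T. u n t - f t) in sqrt (Re (ip d d))) \<longlonglongrightarrow> 0"

locale reproducing_kernel_hilbert_space = function_hilbert_space T H ip
  for T :: "'t set" and K :: "'t \<Rightarrow> 't \<Rightarrow> complex" and H ip +
  assumes kernel_closed: "t \<in> T \<Longrightarrow> (\<lambda>s\<in>T. K s t) \<in> H"
    and reproducing: "\<lbrakk>f \<in> H; t \<in> T\<rbrakk> \<Longrightarrow> ip f (\<lambda>s\<in>T. K s t) = f t"

text \<open>
  By the Moore-Aronszajn theorem a positive definite kernel has exactly one reproducing kernel
  Hilbert space; the following is its underlying set of functions.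
\<close>

definition rkhs :: "'t set \<Rightarrow> ('t \<Rightarrow> 't \<Rightarrow> complex) \<Rightarrow> ('t \<Rightarrow> complex) set" where
  "rkhs T K = (THE H. \<exists>ip. reproducing_kernel_hilbert_space T K H ip)"


section \<open>The complex space \<open>L\<^sup>2\<close>, as equivalence classes of functions\<close>

definition square_integrable :: "'a measure \<Rightarrow> ('a \<Rightarrow> complex) set" where
  "square_integrable M = {f \<in> borel_measurable M. integrable M (\<lambda>x. (cmod (f x))\<^sup>2)}"

definition ae_eq :: "'a measure \<Rightarrow> (('a \<Rightarrow> complex) \<times> ('a \<Rightarrow> complex)) set" where
  "ae_eq M = {(f, g). f \<in> square_integrable M \<and> g \<in> square_integrable M \<and> (AE x in M. f x = g x)}"

definition L2 :: "'a measure \<Rightarrow> ('a \<Rightarrow> complex) set set" where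
  "L2 M = square_integrable M // ae_eq M"

definition L2_class :: "'a measure \<Rightarrow> ('a \<Rightarrow> complex) \<Rightarrow> ('a \<Rightarrow> complex) set" where
  "L2_class M f = ae_eq M `` {f}"

text \<open>
  The inner product and the composition operator are lifted to classes in the manner of
  \<^theory>\<open>HOL.Equiv_Relations\<close>; see \<open>L2_inner_class\<close> and \<open>koopman_class\<close>.
\<close>

definition L2_inner :: "'a measure \<Rightarrow> ('a \<Rightarrow> complex) set \<Rightarrow> ('a \<Rightarrow> complex) set \<Rightarrow> complex" where
  "L2_inner M F G = the_elem (\<Union>f\<in>F. \<Union>g\<in>G. {LINT x|M. f x * cnj (g x)})"

definition L2_adjoint ::
  "'a measure \<Rightarrow> (('a \<Rightarrow> complex) set \<Rightarrow> ('a \<Rightarrow> complex) set) \<Rightarrow> ('a \<Rightarrow> complex) set \<Rightarrow> ('a \<Rightarrow> complex) set"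
  where
  "L2_adjoint M S G = (THE F. F \<in> L2 M \<and> (\<forall>E\<in>L2 M. L2_inner M (S E) G = L2_inner M E F))"

definition koopman :: "'a measure \<Rightarrow> ('a \<Rightarrow> 'a) \<Rightarrow> ('a \<Rightarrow> complex) set \<Rightarrow> ('a \<Rightarrow> complex) set" where
  "koopman M \<sigma> F = (\<Union>f\<in>F. L2_class M (f \<circ> \<sigma>))"


section \<open>The space \<open>\<HH>(\<mu>)\<close> and the Krein-Feller derivative\<close>

definition fin_sets :: "'a measure \<Rightarrow> 'a set set" where
  "fin_sets M = {A \<in> sets M. emeasure M A < \<infinity>}"

definition measure_rkhs :: "'a measure \<Rightarrow> ('a set \<Rightarrow> complex) set" where
  "measure_rkhs M = rkhs (fin_sets M) (\<lambda>A B. complex_of_real (measure M (A \<inter> B)))"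

definition krein_feller :: "'a measure \<Rightarrow> ('a set \<Rightarrow> complex) \<Rightarrow> ('a \<Rightarrow> complex) set" where
  "krein_feller M \<Phi> =
    (THE F. F \<in> L2 M \<and> (\<forall>h\<in>F. \<forall>A\<in>fin_sets M. \<Phi> A = (LINT x:A|M. h x)))"

definition pullback_measure ::
  "'a measure \<Rightarrow> ('a \<Rightarrow> 'a) \<Rightarrow> ('a \<Rightarrow> complex) \<Rightarrow> 'a set \<Rightarrow> complex" where
  "pullback_measure M \<sigma> g = (\<lambda>A\<in>fin_sets M. LINT x|M. indicator A (\<sigma> x) * g x)"


section \<open>Independence of representatives\<close>

lemma equiv_ae_eq: "equiv (square_integrable M) (ae_eq M)"
proof (rule equivI)
  show "ae_eq M \<subseteq> square_integrable M \<times> square_integrable M"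
    by (auto simp: ae_eq_def)
  show "refl_on (square_integrable M) (ae_eq M)"
    by (auto simp: refl_on_def ae_eq_def)
  show "sym (ae_eq M)"
    by (auto simp: sym_def ae_eq_def eq_commute)
  show "trans (ae_eq M)"
    unfolding trans_def ae_eq_def by (auto elim: AE_mp)
qed

lemma L2_class_in_L2: "f \<in> square_integrable M \<Longrightarrow> L2_class M f \<in> L2 M"
  by (simp add: L2_class_def L2_def quotientI)

lemma L2_inner_class:
  assumes f: "f \<in> square_integrable M" and g: "g \<in> square_integrable M"
  shows "L2_inner M (L2_class M f) (L2_class M g) = (LINT x|M. f x * cnj (g x))"
proof -
  let ?I = "\<lambda>f g. {LINT x|M. f x * cnj (g x)}"
  have *: "congruent2 (ae_eq M) (ae_eq M) ?I"
  proof (rule congruent2I')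
    fix f1 f2 g1 g2 assume a: "(f1, f2) \<in> ae_eq M" "(g1, g2) \<in> ae_eq M"
    then have [measurable]: "f1 \<in> borel_measurable M" "f2 \<in> borel_measurable M"
        "g1 \<in> borel_measurable M" "g2 \<in> borel_measurable M"
      by (auto simp: ae_eq_def square_integrable_def)
    have [measurable]: "cnj \<in> borel_measurable borel"
      by (intro borel_measurable_continuous_onI continuous_intros)
    have "AE x in M. f1 x * cnj (g1 x) = f2 x * cnj (g2 x)"
      using a by (auto simp: ae_eq_def)
    then show "{LINT x|M. f1 x * cnj (g1 x)} = {LINT x|M. f2 x * cnj (g2 x)}"
      by (subst integral_cong_AE[where g = "\<lambda>x. f2 x * cnj (g2 x)"]) auto
  qed
  show ?thesis
    unfolding L2_inner_def L2_class_def
    by (subst UN_equiv_class2[where f = ?I, OF equiv_ae_eq equiv_ae_eq * f g]) simp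
qed

lemma koopman_class:
  assumes \<sigma>: "\<sigma> \<in> measurable M M"
    and inv: "\<And>A. A \<in> sets M \<Longrightarrow> emeasure M (\<sigma> -` A \<inter> space M) = emeasure M A"
    and f: "f \<in> square_integrable M"
  shows "f \<circ> \<sigma> \<in> square_integrable M" "koopman M \<sigma> (L2_class M f) = L2_class M (f \<circ> \<sigma>)"
proof -
  note \<sigma>[measurable]
  have distr: "distr M M \<sigma> = M"
    by (rule measure_eqI) (auto simp: emeasure_distr inv)
  have sq: "h \<circ> \<sigma> \<in> square_integrable M" if h: "h \<in> square_integrable M" for h
  proof -
    have [measurable]: "h \<in> borel_measurable M"
      using h by (simp add: square_integrable_def)
    have "integrable (distr M M \<sigma>) (\<lambda>x. (cmod (h x))\<^sup>2)"
      using h by (simp add: square_integrable_def distr)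
    then show ?thesis
      by (simp add: square_integrable_def integrable_distr_eq comp_def)
  qed
  show "f \<circ> \<sigma> \<in> square_integrable M"
    using f by (rule sq)
  have *: "congruent (ae_eq M) (\<lambda>f. L2_class M (f \<circ> \<sigma>))"
  proof (rule congruentI)
    fix f1 f2 assume a: "(f1, f2) \<in> ae_eq M"
    then have m[measurable]: "f1 \<in> borel_measurable M" "f2 \<in> borel_measurable M"
      by (auto simp: ae_eq_def square_integrable_def)
    have "AE x in distr M M \<sigma>. f1 x = f2 x"
      unfolding distr using a by (simp add: ae_eq_def)
    then have "AE x in M. f1 (\<sigma> x) = f2 (\<sigma> x)"
      by (rule AE_distrD[OF \<sigma>])
    then have "(f1 \<circ> \<sigma>, f2 \<circ> \<sigma>) \<in> ae_eq M"
      using a sq by (auto simp: ae_eq_def)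
    then show "L2_class M (f1 \<circ> \<sigma>) = L2_class M (f2 \<circ> \<sigma>)"
      unfolding L2_class_def by (rule equiv_class_eq[OF equiv_ae_eq])
  qed
  show "koopman M \<sigma> (L2_class M f) = L2_class M (f \<circ> \<sigma>)"
    unfolding koopman_def L2_class_def[of M f]
    by (rule UN_equiv_class[where f = "\<lambda>f. L2_class M (f \<circ> \<sigma>)", OF equiv_ae_eq * f])
qed

end

theory Submission
  imports Defs
begin

text \<open>
  The functions \<open>A \<mapsto> \<integral>\<^sub>A h d\<mu>\<close> with \<open>h \<in> L\<^sup>2\<close>, with the inner product of the densities, form a
  Hilbert space by Riesz-Fischer, and \<open>\<integral>\<^sub>A 1\<^sub>B d\<mu> = \<mu> (A \<inter> B)\<close> makes it reproducing; it is the
  only one with this kernel. The functional \<open>f \<mapsto> \<langle>f \<circ> \<sigma>, g\<rangle>\<close> is bounded by invariance of \<open>\<mu>\<close>, so it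
  is \<open>f \<mapsto> \<langle>f, k\<rangle>\<close> for some \<open>k\<close>, which is \<open>S\<^sup>* g\<close>. Taking \<open>f = 1\<^sub>A\<close> gives \<open>M\<^sub>g A = \<integral>\<^sub>A k d\<mu>\<close>.
  Existence of \<open>k\<close> and uniqueness of the kernel space both come from one Riesz
  representation lemma for a bounded functional on a subspace that need not be closed.
\<close>

section \<open>Riesz representation and uniqueness of the kernel space\<close>

context function_hilbert_space
begin

text \<open>The single operation f + c g carries addition and scaling at once, so that linearity
  takes one clause in \<open>Riesz_representation\<close>. The inner restriction brings it into the
  form of the locale axioms.\<close>

lemma comb_eq:
  fixes f g :: "'t \<Rightarrow> complex"
  shows "(\<lambda>t\<in>T. f t + c * g t) = (\<lambda>t\<in>T. f t + (\<lambda>t\<in>T. c * g t) t)"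
  by (intro restrict_ext) simp

lemma comb_closed: "\<lbrakk>f \<in> H; g \<in> H\<rbrakk> \<Longrightarrow> (\<lambda>t\<in>T. f t + c * g t) \<in> H"
  unfolding comb_eq by (intro add_closed scale_closed)

lemma diff_eq_comb:
  fixes f g :: "'t \<Rightarrow> complex"
  shows "(\<lambda>t\<in>T. f t - g t) = (\<lambda>t\<in>T. f t + (-1) * g t)"
  by (intro restrict_ext) simp

lemma diff_closed: "\<lbrakk>f \<in> H; g \<in> H\<rbrakk> \<Longrightarrow> (\<lambda>t\<in>T. f t - g t) \<in> H"
  unfolding diff_eq_comb by (rule comb_closed)

lemma ip_comb_left:
  "\<lbrakk>f \<in> H; g \<in> H; k \<in> H\<rbrakk> \<Longrightarrow> ip (\<lambda>t\<in>T. f t + c * g t) k = ip f k + c * ip g k"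
  unfolding comb_eq by (simp add: ip_add ip_scale scale_closed del: restrict_apply)

lemma ip_comb_right:
  assumes "f \<in> H" "g \<in> H" "k \<in> H"
  shows "ip k (\<lambda>t\<in>T. f t + c * g t) = ip k f + cnj c * ip k g"
  using ip_cnj[of "\<lambda>t\<in>T. f t + c * g t" k] ip_cnj[of f k] ip_cnj[of g k] assms
  by (simp add: ip_comb_left comb_closed)

text \<open>This expansion drives both the Cauchy-Schwarz inequality and the variation of the
  functional \<open>J\<close> in \<open>Riesz_representation\<close>.\<close>

lemma ip_self_comb:
  assumes "f \<in> H" "g \<in> H"
  shows "Re (ip (\<lambda>t\<in>T. f t + c * g t) (\<lambda>t\<in>T. f t + c * g t)) =
    Re (ip f f) + 2 * Re (c * ip g f) + (cmod c)\<^sup>2 * Re (ip g g)"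
proof -
  have "ip (\<lambda>t\<in>T. f t + c * g t) (\<lambda>t\<in>T. f t + c * g t) =
      ip f f + (c * ip g f + cnj (c * ip g f)) + (c * cnj c) * ip g g"
    using assms ip_cnj[of g f]
    by (simp add: ip_comb_left ip_comb_right comb_closed algebra_simps)
  also have "c * cnj c = complex_of_real ((cmod c)\<^sup>2)"
    by (rule complex_norm_square [symmetric])
  finally have "Re (ip (\<lambda>t\<in>T. f t + c * g t) (\<lambda>t\<in>T. f t + c * g t)) =
      Re (ip f f + (c * ip g f + cnj (c * ip g f)) + complex_of_real ((cmod c)\<^sup>2) * ip g g)"
    by (rule arg_cong)
  then show ?thesis
    unfolding complex_add_cnj by (simp del: of_real_power)
qed

lemma Cauchy_Schwarz:
  assumes f: "f \<in> H" and g: "g \<in> H"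
  shows "(cmod (ip f g))\<^sup>2 \<le> Re (ip f f) * Re (ip g g)"
proof -
  define p where "p = (cmod (ip g f))\<^sup>2"
  have *: "0 \<le> Re (ip f f) - 2 * s * p + s\<^sup>2 * p * Re (ip g g)" for s :: real
  proof -
    \<comment> \<open>The phase of \<open>?c\<close> turns the cross term into the real number -s p,
      which leaves a quadratic in the real parameter s.\<close>
    let ?c = "- of_real s * cnj (ip g f)"
    have "cnj (ip g f) * ip g f = complex_of_real p"
      by (simp only: p_def complex_norm_square mult.commute)
    then have 1: "?c * ip g f = - complex_of_real (s * p)"
      by (simp add: mult.assoc)
    have 2: "(cmod ?c)\<^sup>2 = s\<^sup>2 * p"
      by (simp add: norm_mult p_def power_mult_distrib)
    have "0 \<le> Re (ip f f) + 2 * Re (?c * ip g f) + (cmod ?c)\<^sup>2 * Re (ip g g)"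
      using ip_nonneg[OF comb_closed[OF f g, of ?c]] unfolding ip_self_comb[OF f g] .
    then show ?thesis
      unfolding 1 2 by simp
  qed
  have p: "0 \<le> p"
    by (simp add: p_def)
  have "p \<le> Re (ip f f) * Re (ip g g)"
  proof (cases "Re (ip g g) = 0")
    case True
    have "p = 0"
    proof (rule ccontr)
      assume "p \<noteq> 0"
      \<comment> \<open>Here the bound is affine in s, and the chosen s makes its right-hand side
        equal to -1.\<close>
      then show False
        using *[of "(Re (ip f f) + 1) / (2 * p)"] ip_nonneg[OF f] True by simp
    qed
    then show ?thesis
      using True by simp
  next
    case False
    then have "0 < Re (ip g g)"
      using ip_nonneg[OF g] by simp
    \<comment> \<open>The chosen s is the minimiser of the quadratic.\<close>
    then show ?thesis
      using *[of "1 / Re (ip g g)"] by (simp add: field_simps power2_eq_square)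
  qed
  then show ?thesis
    using ip_cnj[OF f g] by (simp add: p_def)
qed

text \<open>
  The minimiser of \<open>\<parallel>u\<parallel>\<^sup>2 - 2 Re (L u)\<close> over \<open>V\<close> need not lie in \<open>V\<close>, but a minimising sequence
  converges in \<open>H\<close>, and its limit represents \<open>L\<close> on \<open>V\<close>.
\<close>

lemma Riesz_representation:
  assumes V: "V \<subseteq> H"
    and V_comb: "\<And>u v c. \<lbrakk>u \<in> V; v \<in> V\<rbrakk> \<Longrightarrow> (\<lambda>t\<in>T. u t + c * v t) \<in> V"
    and L_comb: "\<And>u v c. \<lbrakk>u \<in> V; v \<in> V\<rbrakk> \<Longrightarrow> L (\<lambda>t\<in>T. u t + c * v t) = L u + c * L v"
    and L_bound: "\<And>u. u \<in> V \<Longrightarrow> (cmod (L u))\<^sup>2 \<le> C * Re (ip u u)"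
    and C: "0 \<le> C"
  shows "\<exists>k\<in>H. \<forall>u\<in>V. ip u k = L u"
proof (cases "V = {}")
  case True
  then show ?thesis
    using zero_closed by blast
next
  case False
  define J where "J u = Re (ip u u) - 2 * Re (L u)" for u
  \<comment> \<open>The linear coefficient \<open>ip v u - L v\<close> is the defect of
    \<open>u\<close> as a representing vector, tested on \<open>v\<close>. Near the infimum of
    \<open>J\<close> it has to be small.\<close>
  have J_comb: "J (\<lambda>t\<in>T. u t + c * v t) =
      J u + 2 * Re (c * (ip v u - L v)) + (cmod c)\<^sup>2 * Re (ip v v)"
    if "u \<in> V" "v \<in> V" for u v c
  proof -
    have "u \<in> H" "v \<in> H"
      using that V by auto
    then show ?thesis
      using that by (simp add: J_def ip_self_comb L_comb algebra_simps)
  qed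
  \<comment> \<open>By the bound on \<open>L\<close> and the arithmetic-geometric mean inequality, 2
    |L u| is at most C + |u|^2.\<close>
  have J_lower: "- C \<le> J u" if "u \<in> V" for u
  proof -
    have n: "0 \<le> Re (ip u u)"
      using that V ip_nonneg by auto
    have "(2 * cmod (L u))\<^sup>2 \<le> 4 * (C * Re (ip u u))"
      using L_bound[OF that] by (simp add: power_mult_distrib)
    also have "\<dots> \<le> (C + Re (ip u u))\<^sup>2"
      using zero_le_power2[of "C - Re (ip u u)"] by (simp add: power2_eq_square algebra_simps)
    finally have "2 * cmod (L u) \<le> C + Re (ip u u)"
      by (rule power2_le_imp_le) (use C n in simp)
    then show ?thesis
      using complex_Re_le_cmod[of "L u"] by (simp add: J_def)
  qed
  define I where "I = Inf (J ` V)"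
  have bdd: "bdd_below (J ` V)"
    by (rule bdd_belowI2[OF J_lower])
  have I_le: "I \<le> J u" if "u \<in> V" for u
    unfolding I_def using that bdd by (intro cInf_lower) auto
  have "\<exists>u\<in>V. J u < I + 1 / (real n + 1)" for n
  proof -
    have "I < I + 1 / (real n + 1)"
      by simp
    then show ?thesis
      using False bdd cInf_less_iff[of "J ` V" "I + 1 / (real n + 1)"] by (auto simp: I_def)
  qed
  then obtain u where u: "\<And>n. u n \<in> V" and Ju: "\<And>n. J (u n) < I + 1 / (real n + 1)"
    by metis
  have uH: "u n \<in> H" for n
    using u V by auto
  \<comment> \<open>Parallelogram argument: the midpoint of \<open>u m\<close> and
    \<open>u n\<close> lies in \<open>V\<close>, so \<open>J\<close> is at least \<open>I\<close>
    there. It equals the mean of the two values of \<open>J\<close> minus |d|^2 / 4, which bounds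
    |d|^2 by twice the sum of the two excesses over \<open>I\<close>.\<close>
  have close: "Re (ip (\<lambda>t\<in>T. u m t - u n t) (\<lambda>t\<in>T. u m t - u n t)) \<le>
      2 * (1 / (real m + 1) + 1 / (real n + 1))" for m n
  proof -
    define d where "d = (\<lambda>t\<in>T. u m t - u n t)"
    have d: "d \<in> V"
      unfolding d_def diff_eq_comb by (intro V_comb u)
    have "(\<lambda>t\<in>T. u n t + 1 * d t) = u m"
      using uH extensional by (intro extensionalityI[of _ T]) (auto simp: d_def)
    then have 1: "J (u m) = J (u n) + 2 * Re (ip d (u n) - L d) + Re (ip d d)"
      using J_comb[OF u[of n] d, of 1] by simp
    have "I \<le> J (u n) + Re (ip d (u n) - L d) + Re (ip d d) / 4"
      using I_le[OF V_comb[OF u[of n] d, of "1/2"]] J_comb[OF u[of n] d, of "1/2"]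
      by (simp add: power2_eq_square diff_divide_distrib)
    then have "Re (ip d d) \<le> 2 * (1 / (real m + 1) + 1 / (real n + 1))"
      using 1 Ju[of m] Ju[of n] by argo
    then show ?thesis
      by (simp add: d_def)
  qed
  have "\<forall>e>0. \<exists>N. \<forall>m\<ge>N. \<forall>n\<ge>N.
      (let d = (\<lambda>t\<in>T. u m t - u n t) in sqrt (Re (ip d d)) < e)"
  proof (intro allI impI)
    fix e :: real
    assume "0 < e"
    \<comment> \<open>Each of the two error terms in \<open>close\<close> is allotted half of
      e^2.\<close>
    then obtain N where N: "4 / e\<^sup>2 < real N"
      using reals_Archimedean2 by blast
    have inv: "2 / (real m + 1) < e\<^sup>2 / 2" if "N \<le> m" for m
    proof -
      have "4 / e\<^sup>2 < real m + 1"
        using N that by linarith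
      then show ?thesis
        using \<open>0 < e\<close> by (simp add: field_simps)
    qed
    have "sqrt (Re (ip (\<lambda>t\<in>T. u m t - u n t) (\<lambda>t\<in>T. u m t - u n t))) < e"
      if "N \<le> m" "N \<le> n" for m n
    proof -
      have "Re (ip (\<lambda>t\<in>T. u m t - u n t) (\<lambda>t\<in>T. u m t - u n t)) < e\<^sup>2"
        using close[of m n] inv[OF that(1)] inv[OF that(2)] by simp
      then show ?thesis
        using \<open>0 < e\<close> by (simp add: real_less_lsqrt)
    qed
    then show "\<exists>N. \<forall>m\<ge>N. \<forall>n\<ge>N. (let d = (\<lambda>t\<in>T. u m t - u n t) in sqrt (Re (ip d d)) < e)"
      by (auto simp: Let_def)
  qed
  from complete[of u, OF uH this]
  obtain k where k: "k \<in> H"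
    and lim: "(\<lambda>n. sqrt (Re (ip (\<lambda>t\<in>T. u n t - k t) (\<lambda>t\<in>T. u n t - k t)))) \<longlonglongrightarrow> 0"
    by (auto simp: Let_def)
  show ?thesis
  proof (intro bexI[OF _ k] ballI)
    fix v
    assume v: "v \<in> V"
    then have vH: "v \<in> H"
      using V by auto
    define n where "n = Re (ip v v)"
    have n0: "0 \<le> n"
      unfolding n_def by (rule ip_nonneg[OF vH])
    \<comment> \<open>Moving from \<open>u i\<close> along \<open>v\<close> against the defect D
      lowers \<open>J\<close> by at least s |D|^2, while \<open>J (u i)\<close> exceeds the infimum
      by less than 1 / (i + 1).\<close>
    have bound: "cmod (ip v (u i) - L v) \<le> sqrt ((n + 1) / (real i + 1))" for i
    proof -
      define D where "D = ip v (u i) - L v"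
      \<comment> \<open>The optimal step length is 1 / n; the denominator n + 1 also covers a
        \<open>v\<close> of norm zero.\<close>
      define s where "s = 1 / (n + 1)"
      have s: "0 < s" "s * n \<le> 1"
        using n0 by (auto simp: s_def field_simps)
      let ?c = "- of_real s * cnj D"
      have "cnj D * D = complex_of_real ((cmod D)\<^sup>2)"
        by (simp only: complex_norm_square mult.commute)
      then have 1: "?c * D = - complex_of_real (s * (cmod D)\<^sup>2)"
        by (simp add: mult.assoc)
      have 2: "(cmod ?c)\<^sup>2 = s\<^sup>2 * (cmod D)\<^sup>2"
        by (simp add: norm_mult power_mult_distrib)
      have "I \<le> J (u i) + 2 * Re (?c * D) + (cmod ?c)\<^sup>2 * n"
        using I_le[OF V_comb[OF u[of i] v, of ?c]] unfolding J_comb[OF u v] D_def n_def .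
      then have "2 * (s * (cmod D)\<^sup>2) - s * n * (s * (cmod D)\<^sup>2) \<le> 1 / (real i + 1)"
        unfolding 1 2 using Ju[of i] by (simp add: power2_eq_square algebra_simps)
      moreover have "s * n * (s * (cmod D)\<^sup>2) \<le> 1 * (s * (cmod D)\<^sup>2)"
        using s by (intro mult_right_mono) auto
      ultimately have "s * (cmod D)\<^sup>2 \<le> 1 / (real i + 1)"
        by simp
      then have "(cmod D)\<^sup>2 \<le> (n + 1) / (real i + 1)"
        using n0 by (simp add: s_def field_simps)
      then show ?thesis
        unfolding D_def by (rule real_le_rsqrt)
    qed
    have "(\<lambda>i. sqrt ((n + 1) / (real i + 1))) \<longlonglongrightarrow> 0"
      using tendsto_real_sqrt[OF tendsto_mult_right_zero[OF LIMSEQ_inverse_real_of_nat, of "n + 1"]]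
      by (simp add: divide_inverse add.commute)
    with bound have "(\<lambda>i. ip v (u i) - L v) \<longlonglongrightarrow> 0"
      by (rule Lim_null_comparison[OF always_eventually[OF allI]])
    moreover have "(\<lambda>i. ip v (u i) - ip v k) \<longlonglongrightarrow> 0"
    proof (rule Lim_null_comparison[OF always_eventually])
      have "(\<lambda>i. sqrt n * sqrt (Re (ip (\<lambda>t\<in>T. u i t - k t) (\<lambda>t\<in>T. u i t - k t))))
          \<longlonglongrightarrow> sqrt n * 0"
        by (intro tendsto_intros lim)
      then show "(\<lambda>i. sqrt n * sqrt (Re (ip (\<lambda>t\<in>T. u i t - k t) (\<lambda>t\<in>T. u i t - k t))))
          \<longlonglongrightarrow> 0"
        by simp
      show "\<forall>i. norm (ip v (u i) - ip v k) \<le>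
          sqrt n * sqrt (Re (ip (\<lambda>t\<in>T. u i t - k t) (\<lambda>t\<in>T. u i t - k t)))"
      proof
        fix i
        have "ip v (u i) - ip v k = ip v (\<lambda>t\<in>T. u i t - k t)"
          unfolding diff_eq_comb ip_comb_right[OF uH k vH] by simp
        moreover have "cmod (ip v (\<lambda>t\<in>T. u i t - k t)) \<le>
            sqrt (n * Re (ip (\<lambda>t\<in>T. u i t - k t) (\<lambda>t\<in>T. u i t - k t)))"
          unfolding n_def by (intro real_le_rsqrt Cauchy_Schwarz vH diff_closed uH k)
        ultimately show "norm (ip v (u i) - ip v k) \<le>
            sqrt n * sqrt (Re (ip (\<lambda>t\<in>T. u i t - k t) (\<lambda>t\<in>T. u i t - k t)))"
          by (simp add: real_sqrt_mult)
      qed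
    qed
    \<comment> \<open>The terms \<open>ip v (u i)\<close> cancel, so a constant sequence tends to
      0.\<close>
    ultimately have "(\<lambda>i. (ip v (u i) - L v) - (ip v (u i) - ip v k)) \<longlonglongrightarrow> 0 - 0"
      by (rule tendsto_diff)
    then show "ip v k = L v"
      by (simp add: tendsto_const_iff)
  qed
qed

end

text \<open>
  No span of kernel functions is needed: the vectors on which the two inner products agree
  form a subspace containing all kernel functions.
\<close>

lemma reproducing_kernel_hilbert_space_subset:
  assumes "reproducing_kernel_hilbert_space T K H ip" "reproducing_kernel_hilbert_space T K H' ip'"
  shows "H \<subseteq> H'"
proof
  interpret A: reproducing_kernel_hilbert_space T K H ip by fact
  interpret B: reproducing_kernel_hilbert_space T K H' ip' by fact
  fix f
  assume f: "f \<in> H"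
  \<comment> \<open>Quantifying over all common \<open>w\<close> keeps the condition linear in
    \<open>u\<close>. The case \<open>w = u\<close> says that the two norms agree on
    \<open>V\<close>.\<close>
  define V where "V = {u \<in> H \<inter> H'. \<forall>w \<in> H \<inter> H'. ip u w = ip' u w}"
  have V: "V \<subseteq> H \<inter> H'"
    by (auto simp: V_def)
  \<comment> \<open>The inner product of \<open>H\<close> against \<open>f\<close> is a functional
    on \<open>V\<close>, bounded in the norm of \<open>H'\<close> because the norms agree there.
    Riesz in \<open>H'\<close> yields a \<open>k\<close> that will turn out to be \<open>f\<close>
    itself.\<close>
  have "\<exists>k\<in>H'. \<forall>u\<in>V. ip' u k = ip u f"
  proof (rule B.Riesz_representation[where C = "Re (ip f f)"])
    show "V \<subseteq> H'"
      using V by auto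
    show "0 \<le> Re (ip f f)"
      by (rule A.ip_nonneg[OF f])
  next
    fix u v c
    assume uv: "u \<in> V" "v \<in> V"
    then show "(\<lambda>t\<in>T. u t + c * v t) \<in> V"
      by (auto simp: V_def A.comb_closed B.comb_closed A.ip_comb_left B.ip_comb_left)
    show "ip (\<lambda>t\<in>T. u t + c * v t) f = ip u f + c * ip v f"
      using uv V f by (intro A.ip_comb_left) auto
  next
    fix u
    assume u: "u \<in> V"
    then have "ip' u u = ip u u"
      by (simp add: V_def)
    then show "(cmod (ip u f))\<^sup>2 \<le> Re (ip f f) * Re (ip' u u)"
      using A.Cauchy_Schwarz[of u f] u V f by (auto simp: mult.commute)
  qed
  then obtain k where k: "k \<in> H'" and repr: "\<And>u. u \<in> V \<Longrightarrow> ip' u k = ip u f"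
    by blast
  have "k t = f t" if t: "t \<in> T" for t
  proof -
    let ?K = "\<lambda>s\<in>T. K s t"
    have K: "?K \<in> H" "?K \<in> H'"
      using t by (auto intro: A.kernel_closed B.kernel_closed)
    have ip: "ip ?K w = cnj (w t)" if "w \<in> H" for w
      using A.ip_cnj[OF that K(1)] A.reproducing[OF that t] by simp
    have ip': "ip' ?K w = cnj (w t)" if "w \<in> H'" for w
      using B.ip_cnj[OF that K(2)] B.reproducing[OF that t] by simp
    \<comment> \<open>Against a kernel function both inner products give the conjugate of point
      evaluation, hence they agree on every common \<open>w\<close>.\<close>
    have "?K \<in> V"
      using K by (simp add: V_def ip ip')
    from repr[OF this] show ?thesis
      by (simp add: ip[OF f] ip'[OF k])
  qed
  then have "k = f"
    using A.extensional B.extensional f k by (intro extensionalityI[of _ T]) auto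
  then show "f \<in> H'"
    using k by simp
qed

text \<open>Inclusion in both directions supplies the uniqueness demanded by the definite
  description in \<open>rkhs\<close>.\<close>

lemma rkhs_eq:
  assumes "reproducing_kernel_hilbert_space T K H ip"
  shows "rkhs T K = H"
  unfolding rkhs_def
proof (rule the_equality)
  show "\<exists>ip. reproducing_kernel_hilbert_space T K H ip"
    using assms by blast
next
  fix H'
  assume "\<exists>ip. reproducing_kernel_hilbert_space T K H' ip"
  then show "H' = H"
    using assms by (blast dest: reproducing_kernel_hilbert_space_subset)
qed

section \<open>Completeness of \<open>L\<^sup>2\<close>\<close>

lemma borel_measurable_cnj[measurable]: "cnj \<in> borel_measurable borel"
  by (intro borel_measurable_continuous_onI continuous_intros)

lemma square_integrable_measurable: "f \<in> square_integrable M \<Longrightarrow> f \<in> borel_measurable M"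
  by (simp add: square_integrable_def)

text \<open>Finiteness of an extended integral is the form in which Fatou's lemma delivers square
  integrability of the limit in \<open>L2_complete\<close>.\<close>

lemma square_integrable_iff_nn_integral:
  "f \<in> square_integrable M \<longleftrightarrow>
    f \<in> borel_measurable M \<and> (\<integral>\<^sup>+x. ennreal ((cmod (f x))\<^sup>2) \<partial>M) < \<infinity>"
  by (auto simp: square_integrable_def integrable_iff_bounded)

lemma square_integrable_add:
  assumes "f \<in> square_integrable M" "g \<in> square_integrable M"
  shows "(\<lambda>x. f x + g x) \<in> square_integrable M"
proof -
  have [measurable]: "f \<in> borel_measurable M" "g \<in> borel_measurable M"
    using assms by (auto dest: square_integrable_measurable)
  have "(cmod (f x + g x))\<^sup>2 \<le> 2 * (cmod (f x))\<^sup>2 + 2 * (cmod (g x))\<^sup>2" for x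
  proof -
    have "(cmod (f x + g x))\<^sup>2 \<le> (cmod (f x) + cmod (g x))\<^sup>2"
      by (intro power_mono norm_triangle_ineq) simp
    also have "\<dots> \<le> 2 * (cmod (f x))\<^sup>2 + 2 * (cmod (g x))\<^sup>2"
      using zero_le_power2[of "cmod (f x) - cmod (g x)"]
      by (simp add: power2_eq_square algebra_simps)
    finally show ?thesis .
  qed
  then have le: "AE x in M. norm ((cmod (f x + g x))\<^sup>2) \<le>
      norm (2 * (cmod (f x))\<^sup>2 + 2 * (cmod (g x))\<^sup>2)"
    by simp
  have "integrable M (\<lambda>x. 2 * (cmod (f x))\<^sup>2 + 2 * (cmod (g x))\<^sup>2)"
    using assms by (simp add: square_integrable_def)
  then have "integrable M (\<lambda>x. (cmod (f x + g x))\<^sup>2)"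
    by (rule Bochner_Integration.integrable_bound[OF _ _ le]) measurable
  then show ?thesis
    by (simp add: square_integrable_def)
qed

lemma square_integrable_scale:
  "f \<in> square_integrable M \<Longrightarrow> (\<lambda>x. c * f x) \<in> square_integrable M"
  by (auto simp: square_integrable_def norm_mult power_mult_distrib intro: borel_measurable_times)

lemma square_integrable_diff:
  assumes "f \<in> square_integrable M" "g \<in> square_integrable M"
  shows "(\<lambda>x. f x - g x) \<in> square_integrable M"
  using square_integrable_add[OF assms(1) square_integrable_scale[OF assms(2), of "-1"]] by simp

lemma square_integrable_zero: "(\<lambda>x. 0) \<in> square_integrable M"
  by (simp add: square_integrable_def)

lemma fin_sets_sets: "A \<in> fin_sets M \<Longrightarrow> A \<in> sets M"
  by (simp add: fin_sets_def)

lemma square_integrable_indicator: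
  assumes "A \<in> fin_sets M"
  shows "indicator A \<in> square_integrable M"
proof -
  have "(\<lambda>x. (cmod (indicator A x))\<^sup>2) = indicat_real A"
    by (auto simp: indicator_def)
  then show ?thesis
    using assms by (auto simp: square_integrable_def fin_sets_def)
qed

lemma integrable_mult_cnj:
  assumes "f \<in> square_integrable M" "g \<in> square_integrable M"
  shows "integrable M (\<lambda>x. f x * cnj (g x))"
proof (rule Bochner_Integration.integrable_bound)
  have [measurable]: "f \<in> borel_measurable M" "g \<in> borel_measurable M"
    using assms by (auto dest: square_integrable_measurable)
  show "integrable M (\<lambda>x. (cmod (f x))\<^sup>2 + (cmod (g x))\<^sup>2)"
    using assms by (auto simp: square_integrable_def)
  show "(\<lambda>x. f x * cnj (g x)) \<in> borel_measurable M"
    by measurable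
  have "cmod (f x) * cmod (g x) \<le> (cmod (f x))\<^sup>2 + (cmod (g x))\<^sup>2" for x
    using sum_squares_bound[of "cmod (f x)" "cmod (g x)"]
      mult_nonneg_nonneg[OF norm_ge_zero[of "f x"] norm_ge_zero[of "g x"]] by linarith
  then show "AE x in M. norm (f x * cnj (g x)) \<le> norm ((cmod (f x))\<^sup>2 + (cmod (g x))\<^sup>2)"
    by (simp add: norm_mult)
qed

lemma nn_integral_square_integrable:
  "f \<in> square_integrable M \<Longrightarrow>
    (\<integral>\<^sup>+x. ennreal ((cmod (f x))\<^sup>2) \<partial>M) = ennreal (LINT x|M. (cmod (f x))\<^sup>2)"
  by (intro nn_integral_eq_integral) (auto simp: square_integrable_def)

text \<open>Increments with squared norm below 8^(-k), weighted by 2^k, have a summable total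
  integral, so the weighted squares are summable almost everywhere. This in turn forces absolute
  summability of the increments. Working with squares matters because on an infinite measure space
  the increments themselves may fail to be integrable.\<close>

lemma L2_Cauchy_AE_subsequence:
  assumes h: "\<And>n. h n \<in> square_integrable M"
    and Cauchy: "\<And>e. 0 < e \<Longrightarrow> \<exists>N. \<forall>m\<ge>N. \<forall>n\<ge>N. (LINT x|M. (cmod (h m x - h n x))\<^sup>2) < e"
  obtains r where "\<And>k. k \<le> r k" "AE x in M. convergent (\<lambda>k. h (r k) x)"
proof -
  have [measurable]: "h n \<in> borel_measurable M" for n
    by (rule square_integrable_measurable[OF h])
  have "\<exists>N. \<forall>m\<ge>N. \<forall>n\<ge>N. (LINT x|M. (cmod (h m x - h n x))\<^sup>2) < (1/8)^k" for k :: nat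
    by (rule Cauchy) simp
  then obtain N where N:
    "\<And>k m n. \<lbrakk>N k \<le> m; N k \<le> n\<rbrakk> \<Longrightarrow> (LINT x|M. (cmod (h m x - h n x))\<^sup>2) < (1/8)^k"
    by metis
  \<comment> \<open>The partial sums dominate \<open>N k\<close> at both index k and index k + 1;
    the added k gives \<open>k \<le> r k\<close>.\<close>
  define r where "r k = (\<Sum>i\<le>k. N i) + k" for k
  have r: "k \<le> r k" "N k \<le> r k" "N k \<le> r (Suc k)" for k
    by (auto simp: r_def intro: trans_le_add1 member_le_sum le_SucI)
  define D where "D k x = cmod (h (r (Suc k)) x - h (r k) x)" for k x
  have [measurable]: "D k \<in> borel_measurable M" for k
    unfolding D_def by measurable
  have "(\<integral>\<^sup>+x. (\<Sum>k. ennreal (2^k * (D k x)\<^sup>2)) \<partial>M) =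
      (\<Sum>k. \<integral>\<^sup>+x. ennreal (2^k * (D k x)\<^sup>2) \<partial>M)"
    by (rule nn_integral_suminf) measurable
  also have "\<dots> \<le> (\<Sum>k. ennreal ((1/4)^k))"
  proof (rule suminf_le)
    fix k
    have "(\<integral>\<^sup>+x. ennreal (2^k * (D k x)\<^sup>2) \<partial>M) = ennreal (2^k) * (\<integral>\<^sup>+x. ennreal ((D k x)\<^sup>2) \<partial>M)"
      by (simp add: ennreal_mult nn_integral_cmult)
    also have "\<dots> = ennreal (2^k * (LINT x|M. (D k x)\<^sup>2))"
      unfolding D_def
      by (simp add: nn_integral_square_integrable[OF square_integrable_diff[OF h h]] ennreal_mult)
    also have "\<dots> \<le> ennreal (2^k * (1/8)^k)"
      unfolding D_def by (intro ennreal_leI mult_left_mono less_imp_le N r) simp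
    also have "2^k * (1/8)^k = (1/4 :: real)^k"
      by (simp flip: power_mult_distrib)
    finally show "(\<integral>\<^sup>+x. ennreal (2^k * (D k x)\<^sup>2) \<partial>M) \<le> ennreal ((1/4)^k)" .
  qed auto
  also have "\<dots> = ennreal (\<Sum>k. (1/4)^k)"
    by (rule suminf_ennreal2) (auto intro: summable_geometric)
  finally have "(\<integral>\<^sup>+x. (\<Sum>k. ennreal (2^k * (D k x)\<^sup>2)) \<partial>M) \<noteq> \<infinity>"
    by (auto simp: top_unique)
  then have "AE x in M. (\<Sum>k. ennreal (2^k * (D k x)\<^sup>2)) \<noteq> \<infinity>"
    by (intro nn_integral_noteq_infinite) measurable
  then have "AE x in M. convergent (\<lambda>k. h (r k) x)"
  proof eventually_elim
    fix x
    assume "(\<Sum>k. ennreal (2^k * (D k x)\<^sup>2)) \<noteq> \<infinity>"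
    then have "summable (\<lambda>k. 2^k * (D k x)\<^sup>2)"
      by (intro summable_suminf_not_top) auto
    then have major: "summable (\<lambda>k. (1/2)^k + 2^k * (D k x)\<^sup>2)"
      by (intro summable_add summable_geometric) auto
    \<comment> \<open>Either \<open>D k x\<close> is at most 2^(-k), or 2^k \<open>D k x\<close> is
      at least 1 and multiplying by \<open>D k x\<close> bounds it by the weighted square.\<close>
    have "D k x \<le> (1/2)^k + 2^k * (D k x)\<^sup>2" for k
    proof (cases "D k x \<le> (1/2)^k")
      case True
      then show ?thesis
        by (simp add: add_increasing2)
    next
      case False
      then have "1 \<le> 2^k * D k x"
        by (simp add: power_divide field_simps)
      then have "D k x * 1 \<le> D k x * (2^k * D k x)"
        by (intro mult_left_mono) (auto simp: D_def)
      also have "\<dots> \<le> (1/2)^k + 2^k * (D k x)\<^sup>2"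
        by (simp add: power2_eq_square mult_ac)
      finally show ?thesis
        by simp
    qed
    then have "norm (h (r (Suc k)) x - h (r k) x) \<le> (1/2)^k + 2^k * (D k x)\<^sup>2" for k
      by (simp add: D_def)
    then have "summable (\<lambda>k. h (r (Suc k)) x - h (r k) x)"
      by (rule summable_comparison_test'[OF major])
    then have "convergent (\<lambda>n. \<Sum>k<n. h (r (Suc k)) x - h (r k) x)"
      by (simp add: summable_iff_convergent)
    then have "convergent (\<lambda>n. h (r n) x - h (r 0) x)"
      by (simp add: sum_lessThan_telescope[of "\<lambda>k. h (r k) x"])
    then show "convergent (\<lambda>k. h (r k) x)"
      by (simp add: convergent_diff_const_right_iff)
  qed
  with r(1) show ?thesis
    by (rule that)
qed

text \<open>The limit is taken pointwise along the subsequence. Fatou's lemma, applied to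
  \<open>h n\<close> minus the subsequence, then passes the Cauchy estimate to the limit for every
  large n, so the whole sequence converges.\<close>

lemma L2_complete:
  assumes h: "\<And>n. h n \<in> square_integrable M"
    and Cauchy: "\<And>e. 0 < e \<Longrightarrow> \<exists>N. \<forall>m\<ge>N. \<forall>n\<ge>N. (LINT x|M. (cmod (h m x - h n x))\<^sup>2) < e"
  shows "\<exists>f\<in>square_integrable M. (\<lambda>n. LINT x|M. (cmod (h n x - f x))\<^sup>2) \<longlonglongrightarrow> 0"
proof -
  have [measurable]: "h n \<in> borel_measurable M" for n
    by (rule square_integrable_measurable[OF h])
  obtain r where r: "\<And>k. k \<le> r k" and conv: "AE x in M. convergent (\<lambda>k. h (r k) x)"
    using L2_Cauchy_AE_subsequence[OF h Cauchy] by blast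
  \<comment> \<open>Where the subsequence diverges, \<open>lim\<close> is unspecified; this happens
    only on a null set.\<close>
  define f where "f x = lim (\<lambda>k. h (r k) x)" for x
  have [measurable]: "f \<in> borel_measurable M"
    unfolding f_def by measurable
  \<comment> \<open>The estimate uses extended integrals since square integrability of
    \<open>f\<close> is only derived from it.\<close>
  have bound: "\<exists>N. \<forall>n\<ge>N. (\<integral>\<^sup>+x. ennreal ((cmod (h n x - f x))\<^sup>2) \<partial>M) \<le> ennreal e" if e: "0 < e" for e
  proof -
    obtain N where N: "\<And>m n. \<lbrakk>N \<le> m; N \<le> n\<rbrakk> \<Longrightarrow> (LINT x|M. (cmod (h m x - h n x))\<^sup>2) < e"
      using Cauchy[OF e] by blast
    have "(\<integral>\<^sup>+x. ennreal ((cmod (h n x - f x))\<^sup>2) \<partial>M) \<le> ennreal e" if n: "N \<le> n" for n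
    proof -
      have "AE x in M. ennreal ((cmod (h n x - f x))\<^sup>2) =
          liminf (\<lambda>k. ennreal ((cmod (h n x - h (r k) x))\<^sup>2))"
        using conv
      proof eventually_elim
        fix x
        assume "convergent (\<lambda>k. h (r k) x)"
        then have "(\<lambda>k. h (r k) x) \<longlonglongrightarrow> f x"
          by (simp add: convergent_LIMSEQ_iff f_def)
        then have "(\<lambda>k. ennreal ((cmod (h n x - h (r k) x))\<^sup>2)) \<longlonglongrightarrow> ennreal ((cmod (h n x - f x))\<^sup>2)"
          by (intro tendsto_ennrealI tendsto_intros)
        then show "ennreal ((cmod (h n x - f x))\<^sup>2) =
            liminf (\<lambda>k. ennreal ((cmod (h n x - h (r k) x))\<^sup>2))"
          by (intro lim_imp_Liminf[symmetric]) simp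
      qed
      then have "(\<integral>\<^sup>+x. ennreal ((cmod (h n x - f x))\<^sup>2) \<partial>M) =
          (\<integral>\<^sup>+x. liminf (\<lambda>k. ennreal ((cmod (h n x - h (r k) x))\<^sup>2)) \<partial>M)"
        by (rule nn_integral_cong_AE)
      also have "\<dots> \<le> liminf (\<lambda>k. \<integral>\<^sup>+x. ennreal ((cmod (h n x - h (r k) x))\<^sup>2) \<partial>M)"
        by (rule nn_integral_liminf) measurable
      also have "\<dots> \<le> liminf (\<lambda>k :: nat. ennreal e)"
      proof (rule Liminf_mono)
        have "(\<integral>\<^sup>+x. ennreal ((cmod (h n x - h (r k) x))\<^sup>2) \<partial>M) \<le> ennreal e" if "N \<le> k" for k
          unfolding nn_integral_square_integrable[OF square_integrable_diff[OF h h]]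
          using N[OF n order_trans[OF that r]] by (intro ennreal_leI) simp
        then show "\<forall>\<^sub>F k in sequentially.
            (\<integral>\<^sup>+x. ennreal ((cmod (h n x - h (r k) x))\<^sup>2) \<partial>M) \<le> ennreal e"
          by (rule eventually_sequentiallyI)
      qed
      also have "\<dots> = ennreal e"
        by (simp add: Liminf_const)
      finally show ?thesis .
    qed
    then show ?thesis
      by blast
  qed
  have f: "f \<in> square_integrable M"
  proof -
    obtain n where "(\<integral>\<^sup>+x. ennreal ((cmod (h n x - f x))\<^sup>2) \<partial>M) \<le> ennreal 1"
      using bound[of 1] by auto
    then have "(\<lambda>x. h n x - f x) \<in> square_integrable M"
      by (auto simp: square_integrable_iff_nn_integral intro: le_less_trans)
    from square_integrable_diff[OF h[of n] this] show ?thesis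
      by simp
  qed
  have "(\<lambda>n. LINT x|M. (cmod (h n x - f x))\<^sup>2) \<longlonglongrightarrow> 0"
  proof (rule LIMSEQ_I)
    fix e :: real
    assume "0 < e"
    then obtain N where N: "\<And>n. N \<le> n \<Longrightarrow>
        (\<integral>\<^sup>+x. ennreal ((cmod (h n x - f x))\<^sup>2) \<partial>M) \<le> ennreal (e / 2)"
      using bound[of "e / 2"] by auto
    have "norm ((LINT x|M. (cmod (h n x - f x))\<^sup>2) - 0) < e" if "N \<le> n" for n
    proof -
      have "(LINT x|M. (cmod (h n x - f x))\<^sup>2) \<le> e / 2"
        using N[OF that] \<open>0 < e\<close>
        unfolding nn_integral_square_integrable[OF square_integrable_diff[OF h f]]
        by (subst (asm) ennreal_le_iff) auto
      then show ?thesis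
        using \<open>0 < e\<close> by simp
    qed
    then show "\<exists>N. \<forall>n\<ge>N. norm ((LINT x|M. (cmod (h n x - f x))\<^sup>2) - 0) < e"
      by blast
  qed
  with f show ?thesis
    by blast
qed

section \<open>Indefinite integrals as a reproducing kernel Hilbert space\<close>

definition indefinite_integral :: "'a measure \<Rightarrow> ('a \<Rightarrow> complex) \<Rightarrow> 'a set \<Rightarrow> complex" where
  "indefinite_integral M h = (\<lambda>A\<in>fin_sets M. LINT x:A|M. h x)"

text \<open>The indicator is real, so the conjugate changes nothing; in this shape evaluation at
  \<open>A\<close> is the inner product of the density with \<open>indicator A\<close>, which is the
  reproducing property.\<close>

lemma indefinite_integral_eq:
  "A \<in> fin_sets M \<Longrightarrow> indefinite_integral M h A = (LINT x|M. h x * cnj (indicator A x))"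
  by (auto simp: indefinite_integral_def set_lebesgue_integral_def indicator_def
      intro!: Bochner_Integration.integral_cong)

lemma cnj_integral_mult_cnj: "cnj (LINT x|M. f x * cnj (g x)) = (LINT x|M. g x * cnj (f x))"
proof -
  have "cnj (LINT x|M. f x * cnj (g x)) = (LINT x|M. cnj (f x * cnj (g x)))"
    by (rule Bochner_Integration.integral_cnj [symmetric])
  also have "\<dots> = (LINT x|M. g x * cnj (f x))"
    by (rule Bochner_Integration.integral_cong) simp_all
  finally show ?thesis .
qed

lemma indefinite_integral_add:
  assumes "f \<in> square_integrable M" "g \<in> square_integrable M"
  shows "(\<lambda>A\<in>fin_sets M. indefinite_integral M f A + indefinite_integral M g A) =
    indefinite_integral M (\<lambda>x. f x + g x)"
proof (rule extensionalityI[of _ "fin_sets M"])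
  fix A assume A: "A \<in> fin_sets M"
  show "(\<lambda>A\<in>fin_sets M. indefinite_integral M f A + indefinite_integral M g A) A =
    indefinite_integral M (\<lambda>x. f x + g x) A"
    using A assms
    by (simp add: indefinite_integral_eq distrib_right integrable_mult_cnj square_integrable_indicator)
qed (auto simp: indefinite_integral_def)

lemma indefinite_integral_scale:
  "(\<lambda>A\<in>fin_sets M. c * indefinite_integral M f A) = indefinite_integral M (\<lambda>x. c * f x)"
  by (rule extensionalityI[of _ "fin_sets M"])
    (auto simp: indefinite_integral_eq mult.assoc, auto simp: indefinite_integral_def)

lemma indefinite_integral_diff:
  assumes "f \<in> square_integrable M" "g \<in> square_integrable M"
  shows "(\<lambda>A\<in>fin_sets M. indefinite_integral M f A - indefinite_integral M g A) =
    indefinite_integral M (\<lambda>x. f x - g x)"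
proof -
  have "(\<lambda>A\<in>fin_sets M. indefinite_integral M f A - indefinite_integral M g A) =
    (\<lambda>A\<in>fin_sets M. indefinite_integral M f A +
      (\<lambda>A\<in>fin_sets M. (-1) * indefinite_integral M g A) A)"
    by (intro restrict_ext) simp
  also have "\<dots> = indefinite_integral M (\<lambda>x. f x + (-1) * g x)"
    unfolding indefinite_integral_scale
    by (intro indefinite_integral_add square_integrable_scale assms)
  finally show ?thesis
    by simp
qed

lemma indefinite_integral_cong_AE:
  assumes "f \<in> square_integrable M" "g \<in> square_integrable M" "AE x in M. f x = g x"
  shows "indefinite_integral M f = indefinite_integral M g"
proof -
  have [measurable]: "f \<in> borel_measurable M" "g \<in> borel_measurable M"
    using assms by (auto dest: square_integrable_measurable)
  show ?thesis
    unfolding indefinite_integral_def set_lebesgue_integral_def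
    using assms(3)
    by (intro restrict_ext integral_cong_AE)
      (auto dest: fin_sets_sets intro!: borel_measurable_scaleR borel_measurable_indicator)
qed

text \<open>A square integrable \<open>f\<close> becomes integrable after restriction to a set of
  finite measure. There \<open>density_zero\<close> applies, and countably many such sets cover the
  space.\<close>

lemma (in sigma_finite_measure) indefinite_integral_eq_zero_AE:
  assumes f: "f \<in> square_integrable M" and zero: "\<And>A. A \<in> fin_sets M \<Longrightarrow> indefinite_integral M f A = 0"
  shows "AE x in M. f x = 0"
proof -
  obtain A :: "nat \<Rightarrow> 'a set" where A: "range A \<subseteq> sets M" "(\<Union>i. A i) = space M"
    "\<And>i. emeasure M (A i) \<noteq> \<infinity>"
    by (rule sigma_finite) blast
  have fin: "A i \<inter> B \<in> fin_sets M" if "B \<in> sets M" for i B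
    using A that emeasure_mono[of "A i \<inter> B" "A i" M]
    by (auto simp: fin_sets_def less_top[symmetric] top_unique)
  have "AE x in M. f x * cnj (indicator (A i) x) = 0" for i
  proof (rule density_zero)
    show "integrable M (\<lambda>x. f x * cnj (indicator (A i) x))"
      using fin[OF sets.top, of i] A(1) by (intro integrable_mult_cnj f square_integrable_indicator)
        (simp add: range_subsetD sets.Int_space_eq2)
    fix B assume B: "B \<in> sets M"
    have "(LINT x:B|M. f x * cnj (indicator (A i) x)) = indefinite_integral M f (A i \<inter> B)"
      unfolding indefinite_integral_eq[OF fin[OF B]] set_lebesgue_integral_def
      by (intro Bochner_Integration.integral_cong) (auto simp: indicator_def)
    then show "(LINT x:B|M. f x * cnj (indicator (A i) x)) = 0"
      using zero[OF fin[OF B]] by simp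
  qed
  then have "AE x in M. \<forall>i. f x * cnj (indicator (A i) x) = 0"
    unfolding AE_all_countable by blast
  then show ?thesis
    using AE_space
  proof eventually_elim
    case (elim x)
    then obtain i where "x \<in> A i"
      using A(2) by blast
    with elim(1) show ?case
      by (auto dest: spec[of _ i])
  qed
qed

lemma (in sigma_finite_measure) indefinite_integral_inj_AE:
  assumes f: "f \<in> square_integrable M" and g: "g \<in> square_integrable M"
    and eq: "\<And>A. A \<in> fin_sets M \<Longrightarrow> indefinite_integral M f A = indefinite_integral M g A"
  shows "AE x in M. f x = g x"
proof -
  have "indefinite_integral M (\<lambda>x. f x - g x) A = 0" if "A \<in> fin_sets M" for A
    using that eq by (simp flip: indefinite_integral_diff[OF f g])
  then have "AE x in M. f x - g x = 0"
    by (intro indefinite_integral_eq_zero_AE square_integrable_diff f g)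
  then show ?thesis
    by simp
qed

section \<open>Classes of densities, the Krein-Feller derivative and the kernel space\<close>

lemma L2_class_eqI:
  "\<lbrakk>f \<in> square_integrable M; g \<in> square_integrable M; AE x in M. f x = g x\<rbrakk> \<Longrightarrow>
    L2_class M f = L2_class M g"
  unfolding L2_class_def by (rule equiv_class_eq[OF equiv_ae_eq]) (simp add: ae_eq_def)

lemma L2_cases:
  assumes "F \<in> L2 M"
  obtains f where "f \<in> square_integrable M" "F = L2_class M f"
  using assms unfolding L2_def by (rule quotientE) (rule that, auto simp: L2_class_def)

lemma L2_class_iff: "g \<in> L2_class M f \<longleftrightarrow> (f, g) \<in> ae_eq M"
  by (simp add: L2_class_def)

text \<open>Existence rests on almost everywhere equal densities having the same integrals,
  uniqueness on sigma-finiteness through \<open>indefinite_integral_inj_AE\<close>.\<close>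

lemma (in sigma_finite_measure) krein_feller_eqI:
  assumes h: "h \<in> square_integrable M"
    and eq: "\<And>A. A \<in> fin_sets M \<Longrightarrow> \<Phi> A = indefinite_integral M h A"
  shows "krein_feller M \<Phi> = L2_class M h"
  unfolding krein_feller_def
proof (rule the_equality)
  have "\<Phi> A = (LINT x:A|M. k x)" if "k \<in> L2_class M h" "A \<in> fin_sets M" for k A
  proof -
    have "indefinite_integral M h = indefinite_integral M k"
      using that by (intro indefinite_integral_cong_AE) (auto simp: L2_class_iff ae_eq_def)
    then have "\<Phi> A = indefinite_integral M k A"
      using eq that by simp
    then show ?thesis
      using that by (simp add: indefinite_integral_def)
  qed
  then show "L2_class M h \<in> L2 M \<and> (\<forall>k\<in>L2_class M h. \<forall>A\<in>fin_sets M. \<Phi> A = (LINT x:A|M. k x))"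
    using L2_class_in_L2[OF h] by blast
next
  fix F
  assume F: "F \<in> L2 M \<and> (\<forall>k\<in>F. \<forall>A\<in>fin_sets M. \<Phi> A = (LINT x:A|M. k x))"
  then obtain k where k: "k \<in> square_integrable M" "F = L2_class M k"
    by (auto elim: L2_cases)
  have "k \<in> F"
    using k by (simp add: L2_class_iff ae_eq_def)
  with F have "AE x in M. k x = h x"
    by (intro indefinite_integral_inj_AE k h) (simp add: eq[symmetric], simp add: indefinite_integral_def)
  then show "F = L2_class M h"
    unfolding k(2) by (intro L2_class_eqI k h)
qed

text \<open>Pulling the inner product back along \<open>krein_feller\<close> avoids a choice of
  densities and builds in the isometry with L2.\<close>

definition integral_ip :: "'a measure \<Rightarrow> ('a set \<Rightarrow> complex) \<Rightarrow> ('a set \<Rightarrow> complex) \<Rightarrow> complex" where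
  "integral_ip M \<Phi> \<Psi> = L2_inner M (krein_feller M \<Phi>) (krein_feller M \<Psi>)"

lemma (in sigma_finite_measure) integral_ip_eq:
  "\<lbrakk>f \<in> square_integrable M; g \<in> square_integrable M\<rbrakk> \<Longrightarrow>
    integral_ip M (indefinite_integral M f) (indefinite_integral M g) = (LINT x|M. f x * cnj (g x))"
  by (simp add: integral_ip_def krein_feller_eqI L2_inner_class)

lemma (in sigma_finite_measure) integral_ip_self:
  assumes "f \<in> square_integrable M"
  shows "integral_ip M (indefinite_integral M f) (indefinite_integral M f) =
    of_real (LINT x|M. (cmod (f x))\<^sup>2)"
  unfolding integral_ip_eq[OF assms assms]
  by (simp only: complex_norm_square[symmetric] integral_complex_of_real)

lemma (in sigma_finite_measure) measure_rkhs_locale: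
  "reproducing_kernel_hilbert_space (fin_sets M) (\<lambda>A B. complex_of_real (measure M (A \<inter> B)))
    (indefinite_integral M ` square_integrable M) (integral_ip M)"
proof (intro reproducing_kernel_hilbert_space.intro function_hilbert_space.intro
    reproducing_kernel_hilbert_space_axioms.intro)
  note sq = square_integrable_add square_integrable_scale square_integrable_diff
  let ?I = "indefinite_integral M" and ?S = "square_integrable M" and ?ip = "integral_ip M"
  have zero: "(\<lambda>A\<in>fin_sets M. 0) = ?I (\<lambda>x. 0)"
    by (simp add: indefinite_integral_def set_lebesgue_integral_def)
  show "?I ` ?S \<subseteq> extensional (fin_sets M)"
    by (auto simp: indefinite_integral_def)
  show "(\<lambda>A\<in>fin_sets M. 0) \<in> ?I ` ?S"
    unfolding zero by (intro imageI square_integrable_zero)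
  fix \<Phi> \<Psi> assume "\<Phi> \<in> ?I ` ?S" "\<Psi> \<in> ?I ` ?S"
  then obtain f g where f: "f \<in> ?S" "\<Phi> = ?I f" and g: "g \<in> ?S" "\<Psi> = ?I g"
    by auto
  show "(\<lambda>A\<in>fin_sets M. \<Phi> A + \<Psi> A) \<in> ?I ` ?S"
    using f g by (simp only: indefinite_integral_add sq imageI)
  show "?ip \<Psi> \<Phi> = cnj (?ip \<Phi> \<Psi>)"
    using f g by (simp add: integral_ip_eq cnj_integral_mult_cnj)
  show "(\<lambda>A\<in>fin_sets M. c * \<Phi> A) \<in> ?I ` ?S" for c
    using f by (simp only: indefinite_integral_scale sq imageI)
  show "?ip (\<lambda>A\<in>fin_sets M. c * \<Phi> A) \<Psi> = c * ?ip \<Phi> \<Psi>" for c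
    using f g by (simp add: indefinite_integral_scale integral_ip_eq sq mult.assoc del: restrict_apply)
  show "0 \<le> Re (?ip \<Phi> \<Phi>)"
    using f by (simp add: integral_ip_self)
  show "?ip (\<lambda>A\<in>fin_sets M. \<Phi> A + \<Psi> A) \<Xi> = ?ip \<Phi> \<Xi> + ?ip \<Psi> \<Xi>" if "\<Xi> \<in> ?I ` ?S" for \<Xi>
    using f g that
    by (auto simp: indefinite_integral_add integral_ip_eq sq distrib_right integrable_mult_cnj
        simp del: restrict_apply)
  show "\<Phi> = (\<lambda>A\<in>fin_sets M. 0)" if "?ip \<Phi> \<Phi> = 0"
  proof -
    have "(LINT x|M. (cmod (f x))\<^sup>2) = 0"
      using that f by (simp add: integral_ip_self)
    then have "AE x in M. f x = 0"
      using f by (subst (asm) integral_nonneg_eq_0_iff_AE) (auto simp: square_integrable_def)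
    then show ?thesis
      unfolding zero f(2) by (intro indefinite_integral_cong_AE f square_integrable_zero)
  qed
next
  let ?I = "indefinite_integral M" and ?S = "square_integrable M" and ?ip = "integral_ip M"
  fix A assume A: "A \<in> fin_sets M"
  \<comment> \<open>The kernel function at \<open>A\<close> has density \<open>indicator A\<close>,
    so reproduction reduces to \<open>indefinite_integral_eq\<close>.\<close>
  have kernel: "(\<lambda>B\<in>fin_sets M. complex_of_real (measure M (B \<inter> A))) = ?I (indicator A)"
  proof (rule extensionalityI[of _ "fin_sets M"])
    fix B assume B: "B \<in> fin_sets M"
    have "?I (indicator A) B = (LINT x|M. complex_of_real (indicat_real (B \<inter> A) x))"
      unfolding indefinite_integral_eq[OF B]
      by (intro Bochner_Integration.integral_cong) (auto simp: indicator_def)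
    also have "\<dots> = complex_of_real (measure M (B \<inter> A))"
      unfolding integral_complex_of_real using fin_sets_sets[OF A] fin_sets_sets[OF B]
      by (simp add: Int_absorb2 sets.sets_into_space le_infI1)
    finally show "(\<lambda>B\<in>fin_sets M. complex_of_real (measure M (B \<inter> A))) B = ?I (indicator A) B"
      using B by simp
  qed (auto simp: indefinite_integral_def)
  show "(\<lambda>B\<in>fin_sets M. complex_of_real (measure M (B \<inter> A))) \<in> ?I ` ?S"
    unfolding kernel by (intro imageI square_integrable_indicator A)
  fix \<Phi> assume "\<Phi> \<in> ?I ` ?S"
  then show "?ip \<Phi> (\<lambda>B\<in>fin_sets M. complex_of_real (measure M (B \<inter> A))) = \<Phi> A"
    unfolding kernel using A
    by (auto simp: integral_ip_eq square_integrable_indicator indefinite_integral_eq)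
next
  let ?I = "indefinite_integral M" and ?S = "square_integrable M" and ?ip = "integral_ip M"
  fix u :: "nat \<Rightarrow> 'a set \<Rightarrow> complex"
  assume "\<And>n. u n \<in> ?I ` ?S"
  then have "\<forall>n. \<exists>f. f \<in> ?S \<and> u n = ?I f"
    by blast
  then obtain h where h: "\<And>n. h n \<in> ?S" and u: "\<And>n. u n = ?I (h n)"
    by metis
  \<comment> \<open>The locale's distance is the L2 distance of densities, which transfers both the
    Cauchy hypothesis and the convergence goal.\<close>
  have dist: "sqrt (Re (?ip (\<lambda>A\<in>fin_sets M. ?I f A - ?I g A) (\<lambda>A\<in>fin_sets M. ?I f A - ?I g A))) =
      sqrt (LINT x|M. (cmod (f x - g x))\<^sup>2)" if "f \<in> ?S" "g \<in> ?S" for f g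
    unfolding indefinite_integral_diff[OF that] integral_ip_self[OF square_integrable_diff[OF that]]
    by simp
  assume "\<forall>e>0. \<exists>N. \<forall>m\<ge>N. \<forall>n\<ge>N.
    (let d = (\<lambda>A\<in>fin_sets M. u m A - u n A) in sqrt (Re (?ip d d)) < e)"
  then have Cauchy: "\<exists>N. \<forall>m\<ge>N. \<forall>n\<ge>N. sqrt (LINT x|M. (cmod (h m x - h n x))\<^sup>2) < e"
    if "0 < e" for e
    using that unfolding u Let_def dist[OF h h] by blast
  have "\<exists>f\<in>?S. (\<lambda>n. LINT x|M. (cmod (h n x - f x))\<^sup>2) \<longlonglongrightarrow> 0"
  proof (rule L2_complete[OF h])
    fix e :: real assume "0 < e"
    \<comment> \<open>The locale compares norms and \<open>L2_complete\<close> squared norms, hence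
      the choice \<open>sqrt e\<close>.\<close>
    then show "\<exists>N. \<forall>m\<ge>N. \<forall>n\<ge>N. (LINT x|M. (cmod (h m x - h n x))\<^sup>2) < e"
      using Cauchy[of "sqrt e"] by simp
  qed
  then obtain f where f: "f \<in> ?S" and lim: "(\<lambda>n. LINT x|M. (cmod (h n x - f x))\<^sup>2) \<longlonglongrightarrow> 0"
    by blast
  have "(\<lambda>n. let d = (\<lambda>A\<in>fin_sets M. u n A - ?I f A) in sqrt (Re (?ip d d))) \<longlonglongrightarrow> 0"
    using tendsto_real_sqrt[OF lim] unfolding u Let_def dist[OF h f] by simp
  then show "\<exists>\<Phi>\<in>?I ` ?S. (\<lambda>n. let d = (\<lambda>A\<in>fin_sets M. u n A - \<Phi> A) in sqrt (Re (?ip d d))) \<longlonglongrightarrow> 0"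
    using f by blast
qed

text \<open>With this description, membership in the kernel space amounts to exhibiting a
  density.\<close>

lemma (in sigma_finite_measure) measure_rkhs_eq:
  "measure_rkhs M = indefinite_integral M ` square_integrable M"
  unfolding measure_rkhs_def by (rule rkhs_eq[OF measure_rkhs_locale])

section \<open>The adjoint of the composition operator\<close>

text \<open>Every class has a representative, so the adjoint relation can be checked on functions.
  Indicators of sets of finite measure are enough test functions to make the representing class
  unique.\<close>

lemma (in sigma_finite_measure) L2_adjoint_eqI:
  assumes k: "k \<in> square_integrable M"
    and adj: "\<And>f. f \<in> square_integrable M \<Longrightarrow>
      L2_inner M (S (L2_class M f)) G = (LINT x|M. f x * cnj (k x))"
  shows "L2_adjoint M S G = L2_class M k"
  unfolding L2_adjoint_def
proof (rule the_equality)
  show "L2_class M k \<in> L2 M \<and> (\<forall>E\<in>L2 M. L2_inner M (S E) G = L2_inner M E (L2_class M k))"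
    using k by (auto simp: L2_class_in_L2 L2_inner_class adj elim!: L2_cases)
next
  fix F
  assume F: "F \<in> L2 M \<and> (\<forall>E\<in>L2 M. L2_inner M (S E) G = L2_inner M E F)"
  then obtain l where l: "l \<in> square_integrable M" "F = L2_class M l"
    by (auto elim: L2_cases)
  have *: "(LINT x|M. f x * cnj (l x)) = (LINT x|M. f x * cnj (k x))" if f: "f \<in> square_integrable M" for f
    using F L2_class_in_L2[OF f] adj[OF f] f l by (auto simp: L2_inner_class)
  have "AE x in M. l x = k x"
  proof (rule indefinite_integral_inj_AE[OF l(1) k])
    fix A assume A: "A \<in> fin_sets M"
    \<comment> \<open>Conjugation moves the density from the second slot of the inner product to the
      first, where \<open>indefinite_integral_eq\<close> has it.\<close>
    have "cnj (LINT x|M. indicator A x * cnj (l x)) = cnj (LINT x|M. indicator A x * cnj (k x))"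
      by (rule arg_cong[OF *[OF square_integrable_indicator[OF A]]])
    then show "indefinite_integral M l A = indefinite_integral M k A"
      unfolding indefinite_integral_eq[OF A] cnj_integral_mult_cnj .
  qed
  then show "F = L2_class M k"
    unfolding l(2) by (intro L2_class_eqI l k)
qed

theorem theorem6p1:
  fixes M :: "'a measure" and \<sigma> :: "'a \<Rightarrow> 'a"
  assumes "sigma_finite_measure M"
    and "\<sigma> \<in> measurable M M"
    and "\<And>A. A \<in> sets M \<Longrightarrow> emeasure M (\<sigma> -` A \<inter> space M) = emeasure M A"
  shows "\<forall>g\<in>square_integrable M.
    pullback_measure M \<sigma> g \<in> measure_rkhs M \<and>
    L2_adjoint M (koopman M \<sigma>) (L2_class M g) = krein_feller M (pullback_measure M \<sigma> g)"
proof
  fix g assume g: "g \<in> square_integrable M"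
  interpret sigma_finite_measure M by fact
  let ?I = "indefinite_integral M" and ?S = "square_integrable M" and ?ip = "integral_ip M"
  interpret R: reproducing_kernel_hilbert_space "fin_sets M"
    "\<lambda>A B. complex_of_real (measure M (A \<inter> B))" "?I ` ?S" ?ip
    by (rule measure_rkhs_locale)
  note \<sigma>[measurable] = assms(2)
  have comp: "f \<circ> \<sigma> \<in> ?S" "koopman M \<sigma> (L2_class M f) = L2_class M (f \<circ> \<sigma>)"
    if "f \<in> ?S" for f
    using koopman_class[OF assms(2) _ that] assms(3) by auto
  have distr: "distr M M \<sigma> = M"
    by (rule measure_eqI) (auto simp: emeasure_distr assms(3))
  \<comment> \<open>The Riesz lemma concerns spaces of functions on a set, so the functional on L2
    classes is transported to the kernel space through \<open>krein_feller\<close>.\<close>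
  define L where "L \<Phi> = L2_inner M (koopman M \<sigma> (krein_feller M \<Phi>)) (L2_class M g)" for \<Phi>
  have L: "L (?I f) = (LINT x|M. f (\<sigma> x) * cnj (g x))" if "f \<in> ?S" for f
    using that g comp[OF that] by (simp add: L_def krein_feller_eqI L2_inner_class)
  have norm_comp: "(LINT x|M. (cmod (f (\<sigma> x)))\<^sup>2) = (LINT x|M. (cmod (f x))\<^sup>2)" if "f \<in> ?S" for f
  proof -
    have [measurable]: "f \<in> borel_measurable M"
      by (rule square_integrable_measurable[OF that])
    have "(LINT x|distr M M \<sigma>. (cmod (f x))\<^sup>2) = (LINT x|M. (cmod (f (\<sigma> x)))\<^sup>2)"
      by (rule integral_distr) measurable
    then show ?thesis
      by (simp add: distr)
  qed
  have "\<exists>\<Psi>\<in>?I ` ?S. \<forall>\<Phi>\<in>?I ` ?S. ?ip \<Phi> \<Psi> = L \<Phi>"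
  \<comment> \<open>The subspace is the whole kernel space, and the constant is the squared norm of
    \<open>g\<close>.\<close>
  proof (rule R.Riesz_representation[OF subset_refl R.comb_closed, where C = "Re (?ip (?I g) (?I g))"])
    fix \<Phi> \<Psi> and c :: complex assume "\<Phi> \<in> ?I ` ?S" "\<Psi> \<in> ?I ` ?S"
    then obtain f h where f: "f \<in> ?S" "\<Phi> = ?I f" and h: "h \<in> ?S" "\<Psi> = ?I h"
      by auto
    have "(\<lambda>A\<in>fin_sets M. \<Phi> A + c * \<Psi> A) = ?I (\<lambda>x. f x + c * h x)"
      unfolding R.comb_eq f(2) h(2) indefinite_integral_scale
      by (intro indefinite_integral_add square_integrable_scale f h)
    then show "L (\<lambda>A\<in>fin_sets M. \<Phi> A + c * \<Psi> A) = L \<Phi> + c * L \<Psi>"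
      using f h integrable_mult_cnj[OF comp(1) g]
      by (simp add: L square_integrable_add square_integrable_scale distrib_right mult.assoc comp_def)
  next
    fix \<Phi> assume "\<Phi> \<in> ?I ` ?S"
    then obtain f where f: "f \<in> ?S" "\<Phi> = ?I f"
      by auto
    have "L \<Phi> = ?ip (?I (f \<circ> \<sigma>)) (?I g)"
      using f g comp(1) by (simp add: L integral_ip_eq)
    \<comment> \<open>Invariance of the measure makes composition isometric, so Cauchy-Schwarz for
      \<open>f \<circ> \<sigma>\<close> and \<open>g\<close> bounds \<open>L\<close> in terms of the
      norm of \<open>f\<close>.\<close>
    moreover have "?ip (?I (f \<circ> \<sigma>)) (?I (f \<circ> \<sigma>)) = ?ip \<Phi> \<Phi>"
      using f comp(1) norm_comp by (simp add: integral_ip_self)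
    ultimately show "(cmod (L \<Phi>))\<^sup>2 \<le> Re (?ip (?I g) (?I g)) * Re (?ip \<Phi> \<Phi>)"
      using R.Cauchy_Schwarz[of "?I (f \<circ> \<sigma>)" "?I g"] comp(1)[OF f(1)] g by (simp add: mult.commute)
  next
    show "0 \<le> Re (?ip (?I g) (?I g))"
      using g by (intro R.ip_nonneg imageI)
  qed
  then obtain k where k: "k \<in> ?S"
    and repr: "\<And>f. f \<in> ?S \<Longrightarrow> (LINT x|M. f x * cnj (k x)) = (LINT x|M. f (\<sigma> x) * cnj (g x))"
    by (auto simp: integral_ip_eq L)
  have pullback: "pullback_measure M \<sigma> g = ?I k"
  proof (rule extensionalityI[of _ "fin_sets M"])
    fix A assume A: "A \<in> fin_sets M"
    \<comment> \<open>Testing the adjoint relation on \<open>indicator A\<close> and conjugating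
      frees \<open>k\<close> and \<open>g\<close> of their conjugates, because indicators are
      real.\<close>
    have "cnj (LINT x|M. indicator A x * cnj (k x)) = cnj (LINT x|M. indicator A (\<sigma> x) * cnj (g x))"
      by (rule arg_cong[OF repr[OF square_integrable_indicator[OF A]]])
    also have "cnj (LINT x|M. indicator A (\<sigma> x) * cnj (g x)) = pullback_measure M \<sigma> g A"
      unfolding cnj_integral_mult_cnj using A
      by (auto simp: pullback_measure_def indicator_def intro!: Bochner_Integration.integral_cong)
    finally show "pullback_measure M \<sigma> g A = ?I k A"
      unfolding indefinite_integral_eq[OF A] cnj_integral_mult_cnj by simp
  qed (auto simp: indefinite_integral_def pullback_measure_def)
  have "L2_adjoint M (koopman M \<sigma>) (L2_class M g) = L2_class M k"
    using k g comp by (intro L2_adjoint_eqI) (auto simp: repr L2_inner_class)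
  moreover have "krein_feller M (?I k) = L2_class M k"
    using k by (intro krein_feller_eqI) auto
  ultimately show "pullback_measure M \<sigma> g \<in> measure_rkhs M \<and>
    L2_adjoint M (koopman M \<sigma>) (L2_class M g) = krein_feller M (pullback_measure M \<sigma> g)"
    using k by (simp add: pullback measure_rkhs_eq)
qed

end
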